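(* Let $K$ be an arbitrary field, $A\in\mathcal{A}(m,\Gamma)$, $A'\in\mathcal{A}(m',\Gamma')$ and $\operatorname{ind}(\Gamma)=\{\nu_1,\ldots,\nu_s\}$. Then $A\simeq A'$ (as $K$-algebras) iff $\Gamma=\Gamma'$, $m=m'$, $n(u_{\nu_i})=n(u'_{\nu_i})$ for all $i=1,\ldots,s$, and $\mathbb{T}c(A)=\mathbb{T}c(A')$.
   Context: $\mathbb{S}(m)$ is the set consisting of the empty set and of all non-empty subsets $\Gamma\subseteq\{2,\ldots,m-2\}$ such that $\Gamma+\Gamma\subseteq\Gamma\cup[m,\infty)$. An element of $\Gamma$ is decomposable if it is a sum of two elements of $\Gamma$; $\operatorname{ind}(\Gamma)=\{\nu_1<\cdots<\nu_s\}$ is the set of elements of $\Gamma$ that are not decomposable. $\mathcal{A}(m)$ ($m\geq 2$) is the set of all $K$-subalgebras $A$ of $K[x]$ such that $x^mK[x]\subset A$ and $x^{m-1}\notin A$. For $A\in\mathcal{A}(m)$, $\Gamma_A\in\mathbb{S}(m)$ is the set of integers $\gamma$ with $1\leq\gamma\leq m-1$ such that $A$ contains an element of the form $x^\gamma+\sum_{j>\gamma}\lambda_jx^j$. $\mathcal{A}(m,\Gamma):=\{A\in\mathcal{A}(m)\mid\Gamma_A=\Gamma\}$. The algebra $\overline{A}:=A/x^mK[x]\subseteq K[x]/x^mK[x]$ has a unique $K$-basis $\{1,f_\gamma\mid\gamma\in\Gamma\}$ (the canonical basis) with $f_\gamma=x^\gamma+\sum_{\delta\in C\Gamma(\gamma)}\lambda_{\gamma,\delta}x^\delta$,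 $\lambda_{\gamma,\delta}\in K$, $C\Gamma(\gamma)=\{\delta\mid\delta\notin\Gamma,\gamma<\delta\leq m-1\}$. Write $f_{\nu_i}=x^{\nu_i}u_{\nu_i}$, $u_{\nu_i}=1+\sum_{j\in C\Gamma(\nu_i)}\lambda_{\nu_i,j}x^{j-\nu_i}$; $u'_{\nu_i}$ denotes the corresponding polynomial for $A'$. For each $i$, $c(u_{\nu_i})$ is the vector of the nonzero coefficients $\lambda_{\nu_i,j}$, $j\in C\Gamma(\nu_i)$, of $u_{\nu_i}$ (excluding the constant term $1$), listed with increasing $j$, and $n(u_{\nu_i})$ is the corresponding weight vector with entries $j-\nu_i$ (over the same $j$). Put $c(A)=(c(u_{\nu_1}),\ldots,c(u_{\nu_s}))$ and $n(A)=(n(u_{\nu_1}),\ldots,n(u_{\nu_s}))$. The torus $\mathbb{T}=K^\times$ acts on vectors of nonzero scalars with a given weight vector $(n_1,\ldots,n_k)$ by $\lambda\cdot(\lambda_1,\ldots,\lambda_k)=(\lambda^{n_1}\lambda_1,\ldots,\lambda^{n_k}\lambda_k)$; $\mathbb{T}c(A)$ is the orbit of $c(A)$ under the action with weight vector $n(A)$. *)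

theory Defs
  imports Complex_Main "HOL-Computational_Algebra.Polynomial"
begin

text \<open>The field $K$ is a type of class \<^class>\<open>field\<close>, and $K[x]$ is the type of univariate
  polynomials over it, regarded as a $K$-vector space with scalar multiplication \<^term>\<open>smult\<close>.\<close>

global_interpretation Kx: vector_space "smult :: 'a::field \<Rightarrow> 'a poly \<Rightarrow> 'a poly"
  by unfold_locales (simp_all add: smult_add_left smult_add_right)

definition K_subalgebra :: "'a::field poly set \<Rightarrow> bool" where
  "K_subalgebra A \<longleftrightarrow> Kx.subspace A \<and> 1 \<in> A \<and> (\<forall>p\<in>A. \<forall>q\<in>A. p * q \<in> A)"

definition K_algebra_iso :: "('a::field poly \<Rightarrow> 'a poly) \<Rightarrow> 'a poly set \<Rightarrow> 'a poly set \<Rightarrow> bool" where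
  "K_algebra_iso \<phi> A B \<longleftrightarrow>
     bij_betw \<phi> A B \<and> \<phi> 1 = 1 \<and>
     (\<forall>p\<in>A. \<forall>q\<in>A. \<phi> (p + q) = \<phi> p + \<phi> q) \<and>
     (\<forall>p\<in>A. \<forall>q\<in>A. \<phi> (p * q) = \<phi> p * \<phi> q) \<and>
     (\<forall>c. \<forall>p\<in>A. \<phi> (smult c p) = smult c (\<phi> p))"

definition K_algebras_isomorphic :: "'a::field poly set \<Rightarrow> 'a poly set \<Rightarrow> bool"  (infix "\<simeq>\<^sub>K" 50) where
  "A \<simeq>\<^sub>K B \<longleftrightarrow> (\<exists>\<phi>. K_algebra_iso \<phi> A B)"


definition semigroups :: "nat \<Rightarrow> nat set set"  ("\<S>") where
  "\<S> m = {\<Gamma>. \<Gamma> = {} \<or>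
              (\<Gamma> \<noteq> {} \<and> \<Gamma> \<subseteq> {2..m - 2} \<and> {a + b |a b. a \<in> \<Gamma> \<and> b \<in> \<Gamma>} \<subseteq> \<Gamma> \<union> {m..})}"

definition decomposable :: "nat set \<Rightarrow> nat \<Rightarrow> bool" where
  "decomposable \<Gamma> \<gamma> \<longleftrightarrow> (\<exists>a\<in>\<Gamma>. \<exists>b\<in>\<Gamma>. \<gamma> = a + b)"

definition ind :: "nat set \<Rightarrow> nat set" where
  "ind \<Gamma> = {\<nu> \<in> \<Gamma>. \<not> decomposable \<Gamma> \<nu>}"

definition algebras :: "nat \<Rightarrow> 'a::field poly set set"  ("\<A>") where
  "\<A> m = {A. 2 \<le> m \<and> K_subalgebra A \<and> range (\<lambda>p. monom 1 m * p) \<subseteq> A \<and> monom 1 (m - 1) \<notin> A}"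

definition value_set :: "nat \<Rightarrow> 'a::field poly set \<Rightarrow> nat set" where
  "value_set m A =
     {\<gamma>. 1 \<le> \<gamma> \<and> \<gamma> \<le> m - 1 \<and> (\<exists>p\<in>A. coeff p \<gamma> = 1 \<and> (\<forall>j<\<gamma>. coeff p j = 0))}"

definition algebras_with :: "nat \<Rightarrow> nat set \<Rightarrow> 'a::field poly set set"  ("\<A>\<^sub>\<Gamma>") where
  "\<A>\<^sub>\<Gamma> m \<Gamma> = {A \<in> \<A> m. value_set m A = \<Gamma>}"


definition gaps_above :: "nat \<Rightarrow> nat set \<Rightarrow> nat \<Rightarrow> nat set" where
  "gaps_above m \<Gamma> \<gamma> = {\<delta>. \<delta> \<notin> \<Gamma> \<and> \<gamma> < \<delta> \<and> \<delta> \<le> m - 1}"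

text \<open>The quotient $K[x]/x^m K[x]$ is represented by the remainders modulo $x^m$, on which the
  vector space structure of the quotient is that of $K[x]$. Thus the following set is the
  quotient space $A/x^mK[x]$.\<close>

definition residues :: "nat \<Rightarrow> 'a::field poly set \<Rightarrow> 'a poly set" where
  "residues m A = (\<lambda>p. p mod monom 1 m) ` A"

definition is_canonical_basis :: "nat \<Rightarrow> 'a::field poly set \<Rightarrow> (nat \<Rightarrow> 'a poly) \<Rightarrow> bool" where
  "is_canonical_basis m A f \<longleftrightarrow>
     (\<forall>\<gamma>\<in>value_set m A. \<exists>c.
        f \<gamma> = monom 1 \<gamma> + (\<Sum>\<delta>\<in>gaps_above m (value_set m A) \<gamma>. monom (c \<delta>) \<delta>)) \<and>
     Kx.independent (insert 1 (f ` value_set m A)) \<and>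
     Kx.span (insert 1 (f ` value_set m A)) = residues m A"

text \<open>Outside \<^term>\<open>value_set m A\<close> the family is set to \<^term>\<open>0\<close>, so that it is unique as a total
  function; see \<open>ex1_canonical_basis\<close> below.\<close>

definition canonical_basis :: "nat \<Rightarrow> 'a::field poly set \<Rightarrow> nat \<Rightarrow> 'a poly" where
  "canonical_basis m A =
     (THE f. is_canonical_basis m A f \<and> (\<forall>\<gamma>. \<gamma> \<notin> value_set m A \<longrightarrow> f \<gamma> = 0))"

definition u_poly :: "nat \<Rightarrow> 'a::field poly set \<Rightarrow> nat \<Rightarrow> 'a poly" where
  "u_poly m A \<gamma> = canonical_basis m A \<gamma> div monom 1 \<gamma>"


text \<open>The weight of the coefficient $\lambda_{\nu,j}$ is $j-\nu$, which is the degree of the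
  corresponding monomial of $u_\nu$.\<close>

definition weight_vec :: "'a::field poly \<Rightarrow> nat list" where
  "weight_vec u = sorted_list_of_set {k. 0 < k \<and> coeff u k \<noteq> 0}"

definition coeff_vec :: "'a::field poly \<Rightarrow> 'a list" where
  "coeff_vec u = map (coeff u) (weight_vec u)"

definition weights :: "nat \<Rightarrow> 'a::field poly set \<Rightarrow> nat list" where
  "weights m A = concat (map (\<lambda>\<nu>. weight_vec (u_poly m A \<nu>)) (sorted_list_of_set (ind (value_set m A))))"

definition coeffs_of :: "nat \<Rightarrow> 'a::field poly set \<Rightarrow> 'a list" where
  "coeffs_of m A = concat (map (\<lambda>\<nu>. coeff_vec (u_poly m A \<nu>)) (sorted_list_of_set (ind (value_set m A))))"

definition torus_act :: "nat list \<Rightarrow> 'a::field \<Rightarrow> 'a list \<Rightarrow> 'a list" where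
  "torus_act ns t cs = map2 (\<lambda>n c. t ^ n * c) ns cs"

definition torus_orbit :: "nat list \<Rightarrow> 'a::field list \<Rightarrow> 'a list set" where
  "torus_orbit ns cs = {torus_act ns t cs |t. t \<noteq> 0}"


subsection \<open>Well-definedness\<close>

lemma monom_mult_mem:
  assumes "A \<in> \<A> m" and "\<And>j. j < m \<Longrightarrow> coeff p j = 0"
  shows "p \<in> A"
proof -
  have "monom 1 m dvd p" using assms(2) by (simp add: monom_1_dvd_iff')
  then obtain q where "p = monom 1 m * q" by (auto elim: dvdE)
  then show ?thesis using assms(1) by (auto simp: algebras_def)
qed

lemma algebras_closed:
  assumes "A \<in> \<A> m"
  shows "0 \<in> A" "1 \<in> A" "p \<in> A \<Longrightarrow> q \<in> A \<Longrightarrow> p + q \<in> A" "p \<in> A \<Longrightarrow> q \<in> A \<Longrightarrow> p - q \<in> A"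
    "p \<in> A \<Longrightarrow> smult c p \<in> A" "p \<in> A \<Longrightarrow> q \<in> A \<Longrightarrow> p * q \<in> A"
  using assms Kx.subspace_0 Kx.subspace_add Kx.subspace_diff Kx.subspace_scale
  by (auto simp: algebras_def K_subalgebra_def)

lemma value_set_mem:
  assumes A: "A \<in> \<A> m" and p: "p \<in> A" and "1 \<le> k" "k \<le> m - 1" "coeff p k \<noteq> 0" "\<And>j. j < k \<Longrightarrow> coeff p j = 0"
  shows "k \<in> value_set m A"
proof -
  have "smult (inverse (coeff p k)) p \<in> A" using algebras_closed[OF A] p by blast
  then show ?thesis using assms unfolding value_set_def
    by (intro CollectI conjI bexI[of _ "smult (inverse (coeff p k)) p"]) auto
qed

lemma vanish:
  assumes A: "A \<in> \<A> m" and p: "p \<in> A" and "coeff p 0 = 0"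
    and "\<And>\<gamma>. \<gamma> \<in> value_set m A \<Longrightarrow> coeff p \<gamma> = 0" and "\<And>j. j \<ge> m \<Longrightarrow> coeff p j = 0"
  shows "p = 0"
proof (rule ccontr)
  assume "p \<noteq> 0"
  define k where "k = (LEAST k. coeff p k \<noteq> 0)"
  have k: "coeff p k \<noteq> 0" unfolding k_def using \<open>p \<noteq> 0\<close>
    by (metis (mono_tags, lifting) LeastI leading_coeff_0_iff)
  have l: "coeff p j = 0" if "j < k" for j using that not_less_Least unfolding k_def by blast
  have "k < m" using assms(5) k not_less by blast
  moreover have "k \<noteq> 0" using assms(3) k by metis
  ultimately have "k \<in> value_set m A" using value_set_mem[OF A p] k l by force
  then show False using assms(4) k by blast
qed

lemma value_set_semigroup:
  assumes A: "A \<in> \<A> m"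
  shows "value_set m A \<in> \<S> m"
proof -
  have m: "2 \<le> m" using A by (simp add: algebras_def)
  have top: "m - 1 \<notin> value_set m A"
  proof
    assume "m - 1 \<in> value_set m A"
    then obtain p where p: "p \<in> A" "coeff p (m-1) = 1" "\<And>j. j < m-1 \<Longrightarrow> coeff p j = 0"
      unfolding value_set_def by blast
    have "p - monom 1 (m-1) \<in> A"
    proof (rule monom_mult_mem[OF A])
      fix j assume "j < m"
      then consider "j < m - 1" | "j = m - 1" by linarith
      then show "coeff (p - monom 1 (m-1)) j = 0" by cases (use p in auto)
    qed
    then have "p - (p - monom 1 (m-1)) \<in> A" using algebras_closed[OF A] p(1) by blast
    then show False using A by (simp add: algebras_def)
  qed
  have sum: "a + b \<in> value_set m A" if "a \<in> value_set m A" "b \<in> value_set m A" "a + b < m" for a b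
  proof -
    from that obtain p q where p: "1 \<le> a" "p \<in> A" "coeff p a = 1" "\<And>j. j < a \<Longrightarrow> coeff p j = 0"
      and q: "q \<in> A" "coeff q b = 1" "\<And>j. j < b \<Longrightarrow> coeff q j = 0"
      unfolding value_set_def by blast
    obtain r s where r: "p = monom 1 a * r" and s: "q = monom 1 b * s"
      using p(4) q(3) monom_1_dvd_iff' by (metis dvdE)
    have pq: "p * q = monom 1 (a + b) * (r * s)" unfolding r s by (simp add: mult_monom ac_simps flip: mult.assoc)
    have "coeff r 0 = 1" "coeff s 0 = 1" using p(3) q(2) unfolding r s by (simp_all add: coeff_monom_mult)
    then have "coeff (r * s) 0 = 1" by (simp add: coeff_mult)
    then have "coeff (p * q) (a + b) \<noteq> 0" "\<And>j. j < a + b \<Longrightarrow> coeff (p * q) j = 0"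
      unfolding pq by (simp_all only: coeff_monom_mult) auto
    then show ?thesis using value_set_mem[OF A, of "p * q" "a + b"] algebras_closed(6)[OF A p(2) q(1)] p(1) that(3) m
      by force
  qed
  have bd: "1 \<le> \<gamma> \<and> \<gamma> \<le> m - 1" if "\<gamma> \<in> value_set m A" for \<gamma> using that by (simp add: value_set_def)
  have one: "1 \<notin> value_set m A"
  proof
    assume 1: "1 \<in> value_set m A"
    have "Suc k < m \<longrightarrow> Suc k \<in> value_set m A" for k
    proof (induction k)
      case (Suc k) then show ?case using sum[OF _ 1, of "Suc k"] by auto
    qed (use 1 in auto)
    moreover have "Suc (m - 2) = m - 1" using m by linarith
    ultimately show False using top m by (metis diff_less less_le_trans pos2 zero_less_one)
  qed
  have "value_set m A \<subseteq> {2..m - 2}"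
  proof
    fix \<gamma> assume g: "\<gamma> \<in> value_set m A"
    then have "\<gamma> \<noteq> 1" "\<gamma> \<noteq> m - 1" using one top by metis+
    then show "\<gamma> \<in> {2..m - 2}" using bd[OF g] by auto
  qed
  then show ?thesis unfolding semigroups_def using sum by (auto simp flip: not_less)
qed

lemma residues_eq:
  fixes A :: "'a::field poly set"
  assumes A: "A \<in> \<A> m"
  shows "residues m A = {p \<in> A. \<forall>j\<ge>m. coeff p j = 0}"
proof -
  have m: "p - p mod monom 1 m \<in> A" for p
    by (rule monom_mult_mem[OF A]) (simp add: minus_mod_eq_mult_div coeff_monom_mult)
  have r: "coeff (p mod monom 1 m) j = 0" if "j \<ge> m" for p :: "'a poly" and j
  proof -
    have "p mod monom 1 m = 0 \<or> degree (p mod monom 1 m) < degree (monom (1::'a) m)"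
      by (rule degree_mod_less) simp
    then have "p mod monom 1 m = 0 \<or> degree (p mod monom 1 m) < j"
      using that by (auto simp: degree_monom_eq)
    then show ?thesis by (auto intro: coeff_eq_0)
  qed
  have f: "p mod monom 1 m = p" if "\<forall>j\<ge>m. coeff p j = 0" for p :: "'a poly"
  proof (rule mod_poly_less)
    have "0 < m" using A by (simp add: algebras_def)
    moreover have "degree p \<le> m - 1" by (rule degree_le) (use that in auto)
    ultimately have "degree p < m" by linarith
    then show "degree p < degree (monom (1::'a) m)" by (simp add: degree_monom_eq)
  qed
  have c: "p mod monom 1 m \<in> A" if "p \<in> A" for p
    using algebras_closed(4)[OF A that m[of p]] by simp
  show ?thesis unfolding residues_def
  proof (intro equalityI subsetI)
    fix p assume "p \<in> (\<lambda>p. p mod monom 1 m) ` A"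
    then show "p \<in> {p \<in> A. \<forall>j\<ge>m. coeff p j = 0}" using c r by blast
  next
    fix p assume "p \<in> {p \<in> A. \<forall>j\<ge>m. coeff p j = 0}"
    then have "p \<in> A" "p mod monom 1 m = p" using f by blast+
    then show "p \<in> (\<lambda>p. p mod monom 1 m) ` A" by (metis imageI)
  qed
qed

lemma reduced_element:
  assumes A: "A \<in> \<A> m" and g: "\<gamma> \<in> value_set m A"
  shows "\<exists>p\<in>A. coeff p \<gamma> = 1 \<and> (\<forall>j<\<gamma>. coeff p j = 0) \<and> (\<forall>j\<ge>m. coeff p j = 0) \<and>
    (\<forall>j\<in>value_set m A. j \<noteq> \<gamma> \<longrightarrow> coeff p j = 0)"
proof -
  have "\<exists>p\<in>A. coeff p \<gamma> = 1 \<and> (\<forall>j<\<gamma>. coeff p j = 0) \<and>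
    (\<forall>j\<in>value_set m A. \<gamma> < j \<and> j < k \<longrightarrow> coeff p j = 0)" for k
  proof (induction k)
    case 0
    show ?case using g by (auto simp: value_set_def)
  next
    case (Suc k)
    then obtain p where p: "p \<in> A" "coeff p \<gamma> = 1" "\<forall>j<\<gamma>. coeff p j = 0"
      "\<forall>j\<in>value_set m A. \<gamma> < j \<and> j < k \<longrightarrow> coeff p j = 0" by blast
    show ?case
    proof (cases "k \<in> value_set m A \<and> \<gamma> < k")
      case True
      then obtain q where q: "q \<in> A" "coeff q k = 1" "\<forall>j<k. coeff q j = 0"
        unfolding value_set_def by blast
      show ?thesis
        using p q True algebras_closed(4,5)[OF A]
        by (intro bexI[of _ "p - smult (coeff p k) q"]) (auto simp: less_Suc_eq)
    next
      case False
      then show ?thesis using p by (auto simp: less_Suc_eq)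
    qed
  qed
  from this[of m] obtain p where p: "p \<in> A" "coeff p \<gamma> = 1" "\<forall>j<\<gamma>. coeff p j = 0"
    "\<forall>j\<in>value_set m A. \<gamma> < j \<and> j < m \<longrightarrow> coeff p j = 0" by blast
  define r where "r = p mod monom 1 m"
  have "r \<in> residues m A" using p(1) by (simp add: r_def residues_def)
  then have r: "r \<in> A" "\<forall>j\<ge>m. coeff r j = 0" by (simp_all add: residues_eq[OF A])
  have e: "coeff r j = coeff p j" if "j < m" for j
  proof -
    have "coeff p j = coeff (monom 1 m * (p div monom 1 m) + r) j"
      unfolding r_def by simp
    then show ?thesis using that by (simp add: coeff_monom_mult)
  qed
  have lt: "j < m" if "j \<in> value_set m A" for j
    using that by (auto simp: value_set_def)
  show ?thesis
  proof (intro bexI[of _ r] conjI allI impI ballI)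
    show "coeff r j = 0" if "j \<in> value_set m A" "j \<noteq> \<gamma>" for j
      using e[OF lt[OF that(1)]] p(3,4) that lt[OF that(1)] by (cases "j < \<gamma>") auto
  qed (use r e p lt[OF g] in auto)
qed

lemma gap_form_iff:
  fixes A :: "'a::field poly set" and p :: "'a poly"
  assumes "\<gamma> \<in> value_set m A"
  shows "(\<exists>c. p = monom 1 \<gamma> + (\<Sum>\<delta>\<in>gaps_above m (value_set m A) \<gamma>. monom (c \<delta>) \<delta>)) \<longleftrightarrow>
    coeff p \<gamma> = 1 \<and> (\<forall>j<\<gamma>. coeff p j = 0) \<and> (\<forall>j\<ge>m. coeff p j = 0) \<and>
    (\<forall>j\<in>value_set m A. j \<noteq> \<gamma> \<longrightarrow> coeff p j = 0)" (is "?L \<longleftrightarrow> ?R")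
proof -
  let ?G = "gaps_above m (value_set m A) \<gamma>"
  have fin: "finite ?G" by (rule finite_subset[of _ "{..m}"]) (auto simp: gaps_above_def)
  have c: "coeff (monom 1 \<gamma> + (\<Sum>\<delta>\<in>?G. monom (c \<delta>) \<delta>)) j =
      (if j = \<gamma> then 1 else 0) + (if j \<in> ?G then c j else 0)" for c :: "nat \<Rightarrow> 'a" and j
    using fin by (auto simp: coeff_sum)
  have g: "1 \<le> \<gamma>" "\<gamma> < m" using assms by (auto simp: value_set_def)
  show ?thesis
  proof
    assume ?L
    then obtain d where p: "p = monom 1 \<gamma> + (\<Sum>\<delta>\<in>?G. monom (d \<delta>) \<delta>)" by blast
    show ?R unfolding p c using g assms by (auto simp: gaps_above_def)
  next
    assume R: ?R
    have "p = monom 1 \<gamma> + (\<Sum>\<delta>\<in>?G. monom (coeff p \<delta>) \<delta>)"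
      by (rule poly_eqI, unfold c) (use R g in \<open>auto simp: gaps_above_def not_less not_le\<close>)
    then show ?L by blast
  qed
qed

lemma ex1_canonical_basis:
  fixes A :: "'a::field poly set"
  assumes A: "A \<in> \<A> m"
  shows "\<exists>!f. is_canonical_basis m A f \<and> (\<forall>\<gamma>. \<gamma> \<notin> value_set m A \<longrightarrow> f \<gamma> = 0)"
proof -
  let ?V = "value_set m A"
  let ?P = "\<lambda>\<gamma> p. coeff p \<gamma> = 1 \<and> (\<forall>j<\<gamma>. coeff p j = 0) \<and> (\<forall>j\<ge>m. coeff p j = 0) \<and>
    (\<forall>j\<in>?V. j \<noteq> \<gamma> \<longrightarrow> coeff p j = 0)"
  have fin: "finite ?V" by (rule finite_subset[of _ "{..m}"]) (auto simp: value_set_def)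
  have pos: "0 < \<gamma>" "\<gamma> < m" if "\<gamma> \<in> ?V" for \<gamma> using that by (auto simp: value_set_def)
  have m: "0 < m" using A by (simp add: algebras_def)
  obtain h where h: "\<And>\<gamma>. \<gamma> \<in> ?V \<Longrightarrow> h \<gamma> \<in> A \<and> ?P \<gamma> (h \<gamma>)"
    using reduced_element[OF A] by metis
  define f where "f \<gamma> = (if \<gamma> \<in> ?V then h \<gamma> else 0)" for \<gamma>
  have f: "f \<gamma> \<in> A" "?P \<gamma> (f \<gamma>)" if "\<gamma> \<in> ?V" for \<gamma> using h[OF that] that by (simp_all add: f_def)
  have f0: "coeff (f \<gamma>) 0 = 0" if "\<gamma> \<in> ?V" for \<gamma>
    using f(2)[OF that] pos(1)[OF that] by blast
  have fd: "coeff (f \<gamma>) \<beta> = (if \<gamma> = \<beta> then 1 else 0)" if "\<gamma> \<in> ?V" "\<beta> \<in> ?V" for \<gamma> \<beta>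
    using f(2)[OF that(1)] that(2) by auto
  have res: "residues m A = {p \<in> A. \<forall>j\<ge>m. coeff p j = 0}" by (rule residues_eq[OF A])
  have sub: "Kx.subspace (residues m A)"
    unfolding res Kx.subspace_def using algebras_closed[OF A] by auto
  have inj: "inj_on f ?V"
    by (rule inj_onI) (metis fd zero_neq_one)
  have one: "1 \<notin> f ` ?V" using f0 by (force simp: image_iff dest: arg_cong[of _ _ "\<lambda>p. coeff p 0"])
  have span: "Kx.span (insert 1 (f ` ?V)) = residues m A"
  proof
    show "Kx.span (insert 1 (f ` ?V)) \<subseteq> residues m A"
      by (rule Kx.span_minimal[OF _ sub]) (use f algebras_closed(2)[OF A] m in \<open>auto simp: res\<close>)
    show "residues m A \<subseteq> Kx.span (insert 1 (f ` ?V))"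
    proof
      fix p assume p: "p \<in> residues m A"
      define q where "q = smult (coeff p 0) 1 + (\<Sum>\<gamma>\<in>?V. smult (coeff p \<gamma>) (f \<gamma>))"
      have q: "q \<in> Kx.span (insert 1 (f ` ?V))" unfolding q_def
        by (intro Kx.span_add Kx.span_scale Kx.span_sum Kx.span_base) auto
      then have "q \<in> residues m A" using \<open>Kx.span (insert 1 (f ` ?V)) \<subseteq> residues m A\<close> by blast
      then have pq: "p - q \<in> residues m A" using p Kx.subspace_diff[OF sub] by blast
      have "coeff q 0 = coeff p 0"
        unfolding q_def using f0 by (simp add: coeff_sum)
      moreover have "coeff q \<beta> = coeff p \<beta>" if b: "\<beta> \<in> ?V" for \<beta>
      proof -
        have "(\<Sum>\<gamma>\<in>?V. coeff p \<gamma> * coeff (f \<gamma>) \<beta>) = (\<Sum>\<gamma>\<in>?V. if \<gamma> = \<beta> then coeff p \<gamma> else 0)"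
          by (rule sum.cong) (use fd b in auto)
        then show ?thesis unfolding q_def using fin b pos(1)[OF b] by (simp add: coeff_sum coeff_pCons split: nat.split)
      qed
      ultimately have "p - q = 0" using pq by (intro vanish[OF A]) (auto simp: res)
      then show "p \<in> Kx.span (insert 1 (f ` ?V))" using q by simp
    qed
  qed
  have indep: "Kx.independent (insert 1 (f ` ?V))"
  proof (rule Kx.independent_if_scalars_zero)
    fix c :: "'a poly \<Rightarrow> 'a" and b
    assume "(\<Sum>x\<in>insert 1 (f ` ?V). smult (c x) x) = 0" and b: "b \<in> insert 1 (f ` ?V)"
    then have z: "smult (c 1) 1 + (\<Sum>\<gamma>\<in>?V. smult (c (f \<gamma>)) (f \<gamma>)) = 0" (is "?s = 0")
      using fin one by (simp add: sum.reindex[OF inj])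
    have c1: "coeff ?s 0 = c 1" using f0 by (simp add: coeff_sum)
    have cf: "coeff ?s \<beta> = c (f \<beta>)" if v: "\<beta> \<in> ?V" for \<beta>
    proof -
      have "(\<Sum>\<gamma>\<in>?V. c (f \<gamma>) * coeff (f \<gamma>) \<beta>) = (\<Sum>\<gamma>\<in>?V. if \<gamma> = \<beta> then c (f \<gamma>) else 0)"
        by (rule sum.cong) (use fd v in auto)
      then show ?thesis using fin v pos(1)[OF v] by (simp add: coeff_sum coeff_pCons split: nat.split)
    qed
    from b consider "b = 1" | \<beta> where "\<beta> \<in> ?V" "b = f \<beta>" by blast
    then show "c b = 0" by cases (use c1[unfolded z] cf[unfolded z] in auto)
  qed (use fin in simp)
  have "is_canonical_basis m A f"
    unfolding is_canonical_basis_def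
  proof (intro conjI ballI)
    fix \<gamma> assume v: "\<gamma> \<in> ?V"
    show "\<exists>c. f \<gamma> = monom 1 \<gamma> + (\<Sum>\<delta>\<in>gaps_above m ?V \<gamma>. monom (c \<delta>) \<delta>)"
      unfolding gap_form_iff[OF v] by (rule f(2)[OF v])
  qed (fact indep span)+
  moreover have "f' = f" if f': "is_canonical_basis m A f'" "\<forall>\<gamma>. \<gamma> \<notin> ?V \<longrightarrow> f' \<gamma> = 0" for f'
  proof
    fix \<gamma>
    show "f' \<gamma> = f \<gamma>"
    proof (cases "\<gamma> \<in> ?V")
      case True
      have "f' \<gamma> \<in> Kx.span (insert 1 (f' ` ?V))" using True by (intro Kx.span_base) auto
      then have "f' \<gamma> \<in> A" using f'(1) res by (auto simp: is_canonical_basis_def)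
      then have mem: "f' \<gamma> - f \<gamma> \<in> A" using algebras_closed(4)[OF A] f(1)[OF True] by blast
      have "\<exists>c. f' \<gamma> = monom 1 \<gamma> + (\<Sum>\<delta>\<in>gaps_above m ?V \<gamma>. monom (c \<delta>) \<delta>)"
        using f'(1) True unfolding is_canonical_basis_def by simp
      then have P: "?P \<gamma> (f' \<gamma>)" unfolding gap_form_iff[OF True] .
      have "f' \<gamma> - f \<gamma> = 0"
      proof (rule vanish[OF A mem])
        show "coeff (f' \<gamma> - f \<gamma>) 0 = 0" using P f0[OF True] pos(1)[OF True] by simp
        show "coeff (f' \<gamma> - f \<gamma>) j = 0" if "j \<in> ?V" for j
          using P f(2)[OF True] that by (cases "j = \<gamma>") simp_all
        show "coeff (f' \<gamma> - f \<gamma>) j = 0" if "m \<le> j" for j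
          using P f(2)[OF True] that by simp
      qed
      then show ?thesis by simp
    qed (use f'(2) in \<open>simp add: f_def\<close>)
  qed
  moreover have "\<forall>\<gamma>. \<gamma> \<notin> ?V \<longrightarrow> f \<gamma> = 0" by (simp add: f_def)
  ultimately show ?thesis by blast
qed

end

theory Submission
  imports Defs
begin

text \<open>Any isomorphism \<open>\<phi>\<close> extends to the common field of fractions \<open>K(x)\<close>; the image
  \<open>y = \<phi> (x\<^sup>m\<^sup>+\<^sup>1) / \<phi> (x\<^sup>m)\<close> of \<open>x\<close> is integral over \<open>K[x]\<close>, hence a polynomial, and
  \<open>\<phi> p = p \<circ> y\<close> on \<open>A\<close>. As \<open>x\<^sup>m\<^sup>'\<close> and \<open>x\<^sup>m\<^sup>'\<^sup>+\<^sup>1\<close> are both in the image, \<open>y\<close> is linear, and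
  comparing the conductors \<open>x\<^sup>m K[x]\<close> and \<open>x\<^sup>m\<^sup>' K[x]\<close> gives \<open>y = a x\<close> and \<open>m = m'\<close>. So
  isomorphism means being related by a rescaling of \<open>x\<close>, which acts on the canonical basis by the
  torus action. Conversely the \<open>f\<^sub>\<nu>\<close> with \<open>\<nu>\<close> indecomposable generate \<open>A\<close> modulo \<open>x\<^sup>m K[x]\<close>, so their
  coefficients determine \<open>A\<close>.\<close>

section \<open>Isomorphisms are substitutions\<close>

text \<open>A nonzero combination \<open>d\<close> of least degree divides every combination: the
  remainder modulo \<open>d\<close> is again one, and if nonzero it would have smaller
  degree.\<close>

lemma field_poly_bezout:
  fixes p q :: "'a::field poly"
  assumes "p \<noteq> 0"
  obtains u v where "u * p + v * q \<noteq> 0" "u * p + v * q dvd p" "u * p + v * q dvd q"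
proof -
  define I where "I = {d. d \<noteq> 0 \<and> (\<exists>u v. d = u * p + v * q)}"
  have "p \<in> I" using assms unfolding I_def by (auto intro: exI[of _ 1] exI[of _ 0])
  then obtain d where d: "d \<in> I" and min: "\<And>e. e \<in> I \<Longrightarrow> degree d \<le> degree e"
    using arg_min_nat_lemma[of "\<lambda>d. d \<in> I" p degree] by metis
  from d obtain u v where uv: "d = u * p + v * q" "d \<noteq> 0" unfolding I_def by blast
  have "d dvd s * p + t * q" for s t
  proof (rule ccontr)
    let ?r = "(s * p + t * q) mod d"
    assume "\<not> d dvd s * p + t * q"
    then have "?r \<noteq> 0" by (simp add: dvd_eq_mod_eq_0)
    moreover have "?r = (s - (s * p + t * q) div d * u) * p + (t - (s * p + t * q) div d * v) * q"
      unfolding minus_div_mult_eq_mod[symmetric] by (subst (2) uv(1)) (simp add: algebra_simps)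
    ultimately have "?r \<in> I" unfolding I_def by blast
    moreover have "degree ?r < degree d" using degree_mod_less[OF uv(2)] \<open>?r \<noteq> 0\<close> by blast
    ultimately show False using min by fastforce
  qed
  from this[of 1 0] this[of 0 1] show thesis using that[of u v] uv by simp
qed

text \<open>K[x] is integrally closed: if (q/p)^n is a polynomial, so is q/p. Once the common
  divisor \<open>d\<close> is cancelled, \<open>v * s\<close> is congruent to 1 modulo
  \<open>r\<close>, while \<open>r\<close> divides a power of \<open>v * s\<close>; hence
  \<open>r\<close> is a unit.\<close>

lemma field_poly_pow_dvd_imp_dvd:
  fixes p q :: "'a::field poly"
  assumes "p ^ n dvd q ^ n" "0 < n"
  shows "p dvd q"
proof (cases "p = 0")
  case False
  then obtain u v where d: "u * p + v * q \<noteq> 0" "u * p + v * q dvd p" "u * p + v * q dvd q"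
    by (rule field_poly_bezout)
  define d where "d = u * p + v * q"
  obtain r s where r: "p = d * r" and s: "q = d * s" using d(2,3) unfolding d_def by (auto elim!: dvdE)
  have "d * (u * r + v * s) = u * p + v * q" unfolding r s by (simp add: algebra_simps)
  then have "d * (u * r + v * s) = d * 1" by (simp add: d_def)
  then have one: "u * r + v * s = 1" using d(1) by (metis d_def mult_left_cancel)
  have "d \<noteq> 0" using d(1) by (simp add: d_def)
  then have "r ^ n dvd s ^ n" using assms(1) by (simp add: r s power_mult_distrib)
  then have "r dvd (v * s) ^ n" using assms(2)
    by (metis dvd_power dvd_trans dvd_mult power_mult_distrib)
  moreover have "r dvd (v * s) ^ n - 1"
  proof -
    have "v * s - 1 = r * (- u)" using one by (simp add: algebra_simps)
    then have "r dvd v * s - 1" by (metis dvd_triv_left)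
    also have "v * s - 1 dvd (v * s) ^ n - 1"
      using power_diff_sumr2[of "v * s" n 1] by simp
    finally show ?thesis .
  qed
  ultimately have "r dvd (v * s) ^ n - ((v * s) ^ n - 1)" by (rule dvd_diff)
  then have "r dvd 1" by simp
  then have "r dvd s" using dvd_trans one_dvd by blast
  then show ?thesis unfolding r s by (rule mult_dvd_mono[OF dvd_refl])
qed (use assms in \<open>simp add: power_0_left\<close>)

lemma iso_eq_pcompose:
  fixes A A' :: "'a::field poly set"
  assumes A: "A \<in> \<A> m" and iso: "K_algebra_iso \<phi> A A'"
  obtains y where "\<And>p. p \<in> A \<Longrightarrow> \<phi> p = pcompose p y"
proof -
  note cl = algebras_closed[OF A]
  have add: "\<phi> (p + q) = \<phi> p + \<phi> q" and mult: "\<phi> (p * q) = \<phi> p * \<phi> q"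
    if "p \<in> A" "q \<in> A" for p q using iso that unfolding K_algebra_iso_def by blast+
  have smult: "\<phi> (smult c p) = smult c (\<phi> p)" if "p \<in> A" for c p
    using iso that unfolding K_algebra_iso_def by blast
  have inj: "inj_on \<phi> A" using iso unfolding K_algebra_iso_def bij_betw_def by blast
  have m: "2 \<le> m" using A by (simp add: algebras_def)
  have mon: "monom 1 m * g \<in> A" for g using A by (auto simp: algebras_def)
  have monn: "monom 1 n \<in> A" if "m \<le> n" for n
    by (rule monom_mult_mem[OF A]) (use that in auto)
  have z: "\<phi> 0 = 0" using smult[OF cl(1), of 0] by simp
  define P where "P = \<phi> (monom 1 m)"
  define Q where "Q = \<phi> (monom 1 (Suc m))"
  have P0: "P \<noteq> 0"
    using inj_onD[OF inj, of "monom 1 m" 0] cl(1) monn[of m] z unfolding P_def by auto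
  have pow: "\<phi> (p ^ Suc k) = \<phi> p ^ Suc k \<and> p ^ Suc k \<in> A" if "p \<in> A" for p k
    by (induction k) (use that mult cl(6) in auto)
  \<comment> \<open>Both sides are images of x^(m(m+1)). The relation says that the m-th power of
    Q/P is the polynomial \<open>P\<close>.\<close>
  have "P ^ Suc m = Q ^ m"
  proof -
    have "P ^ Suc m = \<phi> (monom 1 m ^ Suc m)" unfolding P_def using pow monn by simp
    also have "monom (1::'a) m ^ Suc m = monom 1 (Suc m) ^ m"
      by (simp only: monom_power) (simp add: mult.commute)
    also have "\<phi> \<dots> = Q ^ m" unfolding Q_def using pow[of "monom 1 (Suc m)" "m - 1"] monn m by simp
    finally show ?thesis .
  qed
  then have "P ^ m dvd Q ^ m" by (metis dvd_triv_right power_Suc)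
  then have "P dvd Q" using field_poly_pow_dvd_imp_dvd m by force
  then obtain y where Q: "Q = P * y" by (elim dvdE)
  have "P ^ m * P = P ^ m * y ^ m" using \<open>P ^ Suc m = Q ^ m\<close> by (simp add: Q power_mult_distrib mult.commute)
  then have P: "P = y ^ m" using P0 by simp
  \<comment> \<open>As x itself is not in \<open>A\<close>, the factor x is first merged with an
    extra x^m into x^(m+1), which \<open>A\<close> does contain; then \<open>P\<close> is
    cancelled.\<close>
  have shift: "\<phi> (monom 1 m * pCons 0 g) = y * \<phi> (monom 1 m * g)" for g
  proof -
    have "P * \<phi> (monom 1 m * pCons 0 g) = \<phi> (monom 1 m * (monom 1 m * pCons 0 g))"
      unfolding P_def by (rule mult[OF monn[of m] mon, symmetric]) simp
    also have "monom (1::'a) m * (monom 1 m * pCons 0 g) = monom 1 (Suc m) * (monom 1 m * g)"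
      by (simp add: monom_Suc)
    also have "\<phi> \<dots> = Q * \<phi> (monom 1 m * g)" unfolding Q_def using mult[OF monn[of "Suc m"] mon] by simp
    finally show ?thesis using P0 by (simp add: Q mult.assoc)
  qed
  have comp: "\<phi> (monom 1 m * g) = P * pcompose g y" for g
  proof (induction g)
    case 0 show ?case by (simp add: z)
  next
    case (pCons c g)
    have "monom 1 m * pCons c g = smult c (monom 1 m) + monom 1 m * pCons 0 g"
      by (subst mult_pCons_right) (simp add: algebra_simps)
    then have "\<phi> (monom 1 m * pCons c g) = smult c P + y * \<phi> (monom 1 m * g)"
      using add[OF cl(5)[OF monn[of m]] mon, of c "pCons 0 g"] smult[OF monn[of m], of c]
      by (simp only: shift P_def)
    also have "\<dots> = P * pcompose (pCons c g) y"
      unfolding pCons.IH pcompose_pCons by (simp add: algebra_simps)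
    finally show ?case .
  qed
  \<comment> \<open>The product x^m p lies in x^m K[x], where \<open>comp\<close> applies;
    cancelling \<open>P\<close> carries the formula over to \<open>p\<close>.\<close>
  have "\<phi> p = pcompose p y" if "p \<in> A" for p
    using comp[of p] mult[OF monn[of m] that] P0 by (simp add: P_def)
  then show thesis by (rule that)
qed

section \<open>Rescalings of the variable\<close>

abbreviation rescale :: "'a::field \<Rightarrow> 'a poly \<Rightarrow> 'a poly" where
  "rescale a p \<equiv> pcompose p [:0, a:]"

lemma coeff_rescale: "coeff (rescale a p) n = a ^ n * coeff p n"
  by (induction p arbitrary: n) (auto simp: pcompose_pCons coeff_pCons split: nat.split)

lemma rescale_rescale:
  assumes "a * b = 1"
  shows "rescale a (rescale b p) = p"
  by (rule poly_eqI) (use assms in \<open>simp add: coeff_rescale flip: mult.assoc power_mult_distrib\<close>)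

text \<open>As y - a x is a nonzero constant, \<open>y\<close> and \<open>x\<close> are comaximal,
  and so are their powers. Explicitly, b times \<open>y ^ k * x ^ l * g\<close> is a difference of
  two terms with one exponent raised each; \<open>n\<close> counts the exponents still
  missing.\<close>

lemma all_mem_of_coprime_powers:
  fixes x y :: "'a::field poly"
  assumes A: "A' \<in> \<A> m'" and y: "\<And>g. y ^ m * g \<in> A'" and x: "\<And>g. x ^ m' * g \<in> A'"
    and b: "y = smult a x + [:b:]" "b \<noteq> 0"
  shows "g \<in> A'"
proof -
  have "\<forall>g. y ^ k * x ^ l * g \<in> A'" if "m - k + (m' - l) = n" for k l n
    using that
  proof (induction n arbitrary: k l)
    case 0
    then have "y ^ k = y ^ m * y ^ (k - m)" by (simp flip: power_add)
    then show ?case using y by (simp add: mult.assoc)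
  next
    case (Suc n)
    show ?case
    proof (cases "k < m \<and> l < m'")
      case False
      then consider "m \<le> k" | "m' \<le> l" by linarith
      then show ?thesis
      proof cases
        case 1
        then have "y ^ k = y ^ m * y ^ (k - m)" by (simp flip: power_add)
        then show ?thesis using y by (simp add: mult.assoc)
      next
        case 2
        then have "x ^ l = x ^ m' * x ^ (l - m')" by (simp flip: power_add)
        then show ?thesis using x by (simp add: mult.assoc mult.left_commute[of "y ^ k"])
      qed
    next
      case True
      show ?thesis
      proof
        fix g
        have "m - Suc k + (m' - l) = n" "m - k + (m' - Suc l) = n" using Suc.prems True by auto
        then have "y ^ Suc k * x ^ l * g \<in> A'" "y ^ k * x ^ Suc l * smult a g \<in> A'"
          using Suc.IH by blast+
        then have "y ^ Suc k * x ^ l * g - y ^ k * x ^ Suc l * smult a g \<in> A'"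
          using algebras_closed(4)[OF A] by blast
        also have "y ^ Suc k * x ^ l * g - y ^ k * x ^ Suc l * smult a g = smult b (y ^ k * x ^ l * g)"
        proof -
          have "smult b (y ^ k * x ^ l * g) = (y - smult a x) * (y ^ k * x ^ l * g)"
            by (simp add: b(1))
          then show ?thesis by (simp add: algebra_simps)
        qed
        finally have "smult (inverse b) (smult b (y ^ k * x ^ l * g)) \<in> A'"
          using algebras_closed(5)[OF A] by blast
        then show "y ^ k * x ^ l * g \<in> A'" using b(2) by simp
      qed
    qed
  qed
  from this[of 0 0] show ?thesis by simp
qed

text \<open>For k < m the ideal x^k K[x] contains x^(m-1). So \<open>m\<close> is the conductor
  exponent of \<open>A\<close> and can be read off from \<open>A\<close> alone.\<close>

lemma algebras_le_of_monom_mult: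
  assumes "A \<in> \<A> m" "\<And>g. monom 1 k * g \<in> A"
  shows "m \<le> k"
proof (rule ccontr)
  assume "\<not> m \<le> k"
  then have "monom 1 k * monom 1 (m - 1 - k) = (monom 1 (m - 1) :: 'a poly)"
    by (simp add: mult_monom)
  then show False using assms unfolding algebras_def by (metis (mono_tags, lifting) mem_Collect_eq)
qed

lemma iso_imp_rescale:
  fixes A A' :: "'a::field poly set"
  assumes A: "A \<in> \<A> m" and A': "A' \<in> \<A> m'" and "A \<simeq>\<^sub>K A'"
  obtains a where "a \<noteq> 0" "m = m'" "A' = rescale a ` A"
proof -
  from assms(3) obtain \<phi> where iso: "K_algebra_iso \<phi> A A'" unfolding K_algebras_isomorphic_def by blast
  obtain y where y: "\<And>p. p \<in> A \<Longrightarrow> \<phi> p = pcompose p y" using iso_eq_pcompose[OF A iso] by blast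
  have "\<phi> ` A = A'" using iso unfolding K_algebra_iso_def bij_betw_def by blast
  then have img: "A' = (\<lambda>p. pcompose p y) ` A" using y by auto
  \<comment> \<open>Two consecutive exponents are taken because only 1 divides both; each is a
    multiple of the degree of \<open>y\<close>.\<close>
  have mm: "monom 1 m' \<in> A'" "monom 1 (Suc m') \<in> A'" by (rule monom_mult_mem[OF A']; simp)+
  obtain p q where "monom 1 m' = pcompose p y" "monom 1 (Suc m') = pcompose q y"
    using mm unfolding img by blast
  then have "m' = degree p * degree y" "Suc m' = degree q * degree y"
    by (metis degree_monom_eq degree_pcompose one_neq_zero)+
  then have "degree y dvd m'" "degree y dvd Suc m'" by simp_all
  then have deg: "degree y = 1" by (metis Suc_eq_plus1 dvd_add_right_iff nat_dvd_1_iff_1)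
  then obtain b a where yab: "y = [:b, a:]" and a: "a \<noteq> 0"
    by (rule degree1_coeffs)
  \<comment> \<open>The substitution (x - b)/a inverts \<open>y\<close>. Hence every polynomial is a
    composite with \<open>y\<close>, and x^m K[x] is mapped onto the whole ideal generated by
    \<open>y ^ m\<close>.\<close>
  have comp: "pcompose (pcompose g [: - b / a, 1 / a:]) y = g" for g
  proof -
    have "pcompose [: - b / a, 1 / a:] y = [:0, 1:]" using a by (simp add: yab pcompose_pCons)
    then show ?thesis by (metis pcompose_assoc pcompose_idR)
  qed
  have powc: "pcompose (monom 1 k) y = y ^ k" for k
    by (induction k) (simp_all add: monom_Suc pcompose_pCons pcompose_1 flip: one_pCons)
  have ym: "y ^ m * g \<in> A'" for g
  proof -
    have "monom 1 m * pcompose g [: - b / a, 1 / a:] \<in> A" using A by (auto simp: algebras_def)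
    then have "pcompose (monom 1 m * pcompose g [: - b / a, 1 / a:]) y \<in> A'" unfolding img by blast
    then show ?thesis by (simp only: pcompose_mult comp powc)
  qed
  have xm: "[:0, 1:] ^ m' * g \<in> A'" for g
    using A' by (auto simp: algebras_def monom_altdef)
  \<comment> \<open>Otherwise \<open>A'\<close> would be all of K[x], with x^(m'-1) in it.\<close>
  have b: "b = 0"
  proof (rule ccontr)
    assume "b \<noteq> 0"
    have "monom 1 (m' - 1) \<in> A'"
      by (rule all_mem_of_coprime_powers[OF A' ym xm _ \<open>b \<noteq> 0\<close>, of a]) (simp add: yab)
    then show False using A' by (simp add: algebras_def)
  qed
  have y: "y = [:0, a:]" using yab b by simp
  \<comment> \<open>With b = 0, \<open>y ^ m\<close> is a nonzero scalar multiple of x^m, so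
    \<open>A'\<close> contains x^m K[x].\<close>
  have "m' \<le> m"
  proof (rule algebras_le_of_monom_mult[OF A'])
    fix g
    have "y ^ m = smult (a ^ m) (monom 1 m)"
      unfolding y powc[unfolded y, symmetric] by (rule poly_eqI) (simp add: coeff_rescale)
    then have "y ^ m * smult (inverse (a ^ m)) g = monom 1 m * g" using a by simp
    then show "monom 1 m * g \<in> A'" using ym by metis
  qed
  \<comment> \<open>Conversely, the ideal x^m' K[x] is pulled back into \<open>A\<close> along x
    \<mapsto> x/a.\<close>
  moreover have "m \<le> m'"
  proof (rule algebras_le_of_monom_mult[OF A])
    fix g
    have "monom 1 m' * rescale a g \<in> A'" using A' by (auto simp: algebras_def)
    then obtain p where p: "p \<in> A" "monom 1 m' * rescale a g = rescale a p" unfolding img y by blast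
    have "rescale (inverse a) (monom 1 m' * rescale a g) = smult (inverse a ^ m') (monom 1 m' * g)"
      unfolding pcompose_mult rescale_rescale[OF left_inverse[OF a]] mult_smult_left[symmetric]
      by (rule arg_cong[of _ _ "\<lambda>p. p * g"], rule poly_eqI) (simp add: coeff_rescale)
    then have "smult (a ^ m') p = monom 1 m' * g" unfolding p(2) rescale_rescale[OF left_inverse[OF a]]
      using a by (simp add: power_inverse)
    then show "monom 1 m' * g \<in> A" using algebras_closed(5)[OF A p(1)] by metis
  qed
  ultimately show thesis using that a img y by simp
qed

lemma rescale_imp_iso:
  assumes "a \<noteq> 0"
  shows "A \<simeq>\<^sub>K rescale a ` A"
proof -
  have "inj_on (rescale a) A"
    by (rule inj_on_inverseI[where g = "rescale (inverse a)"]) (simp add: rescale_rescale assms)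
  then have "K_algebra_iso (rescale a) A (rescale a ` A)"
    unfolding K_algebra_iso_def
    by (simp add: bij_betw_def pcompose_add pcompose_mult pcompose_smult pcompose_1)
  then show ?thesis unfolding K_algebras_isomorphic_def by blast
qed

section \<open>The canonical basis\<close>

text \<open>Trades the definite description for conditions on coefficients. Two solutions differ by
  an element of \<open>A\<close> to which \<open>vanish\<close> applies.\<close>

lemma canonical_basis_iff:
  fixes A :: "'a::field poly set"
  assumes A: "A \<in> \<A> m" and g: "\<gamma> \<in> value_set m A"
  shows "p = canonical_basis m A \<gamma> \<longleftrightarrow> p \<in> A \<and> coeff p \<gamma> = 1 \<and> (\<forall>j<\<gamma>. coeff p j = 0) \<and>
    (\<forall>j\<ge>m. coeff p j = 0) \<and> (\<forall>j\<in>value_set m A. j \<noteq> \<gamma> \<longrightarrow> coeff p j = 0)" (is "_ \<longleftrightarrow> ?P p")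
proof -
  let ?f = "canonical_basis m A"
  have f: "is_canonical_basis m A ?f"
    using theI'[OF ex1_canonical_basis[OF A]] unfolding canonical_basis_def by blast
  have "?f \<gamma> \<in> Kx.span (insert 1 (?f ` value_set m A))" using g by (intro Kx.span_base) auto
  then have "?f \<gamma> \<in> A" using f residues_eq[OF A] by (auto simp: is_canonical_basis_def)
  moreover have "\<exists>c. ?f \<gamma> = monom 1 \<gamma> + (\<Sum>\<delta>\<in>gaps_above m (value_set m A) \<gamma>. monom (c \<delta>) \<delta>)"
    using f g unfolding is_canonical_basis_def by blast
  ultimately have Pf: "?P (?f \<gamma>)" unfolding gap_form_iff[OF g] by blast
  moreover have "p = ?f \<gamma>" if P: "?P p"
  proof -
    have g0: "0 < \<gamma>" using g by (simp add: value_set_def)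
    have "p - ?f \<gamma> = 0"
    proof (rule vanish[OF A])
      show "coeff (p - ?f \<gamma>) j = 0" if "j \<in> value_set m A" for j
        using P Pf that by (cases "j = \<gamma>") simp_all
    qed (use P Pf g0 algebras_closed(4)[OF A] in auto)
    then show ?thesis by simp
  qed
  ultimately show ?thesis by blast
qed

lemma u_poly_canonical_basis:
  assumes A: "A \<in> \<A> m" and g: "\<gamma> \<in> value_set m A"
  shows "canonical_basis m A \<gamma> = monom 1 \<gamma> * u_poly m A \<gamma>"
proof -
  have "\<forall>j<\<gamma>. coeff (canonical_basis m A \<gamma>) j = 0" using canonical_basis_iff[OF A g] by blast
  then have "monom 1 \<gamma> dvd canonical_basis m A \<gamma>" by (simp add: monom_1_dvd_iff')
  then show ?thesis unfolding u_poly_def by simp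
qed

lemma coeff_u_poly_0:
  assumes A: "A \<in> \<A> m" and g: "\<gamma> \<in> value_set m A"
  shows "coeff (u_poly m A \<gamma>) 0 = 1"
proof -
  have "coeff (canonical_basis m A \<gamma>) \<gamma> = 1" using canonical_basis_iff[OF A g] by blast
  then show ?thesis by (simp add: u_poly_canonical_basis[OF A g] coeff_monom_mult)
qed

section \<open>Value sets and canonical bases under rescaling\<close>

lemma value_set_rescale:
  assumes A: "A \<in> \<A> m" and A': "rescale a ` A \<in> \<A> m" and a: "a \<noteq> 0"
  shows "value_set m (rescale a ` A) = value_set m A"
proof (intro equalityI subsetI)
  fix k assume k: "k \<in> value_set m (rescale a ` A)"
  then obtain p where p: "p \<in> A" "coeff (rescale a p) k = 1" "\<forall>j<k. coeff (rescale a p) j = 0"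
    unfolding value_set_def by blast
  show "k \<in> value_set m A"
    by (rule value_set_mem[OF A p(1)]) (use p k a in \<open>auto simp: coeff_rescale value_set_def\<close>)
next
  fix k assume k: "k \<in> value_set m A"
  then obtain p where p: "p \<in> A" "coeff p k = 1" "\<forall>j<k. coeff p j = 0"
    unfolding value_set_def by blast
  show "k \<in> value_set m (rescale a ` A)"
    by (rule value_set_mem[OF A', of "rescale a p"]) (use p k a in \<open>auto simp: coeff_rescale value_set_def\<close>)
qed

lemma u_poly_rescale:
  assumes A: "A \<in> \<A> m" and A': "rescale a ` A \<in> \<A> m" and a: "a \<noteq> 0" and g: "\<gamma> \<in> value_set m A"
  shows "u_poly m (rescale a ` A) \<gamma> = rescale a (u_poly m A \<gamma>)"
proof -
  let ?f = "canonical_basis m A \<gamma>"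
  have g': "\<gamma> \<in> value_set m (rescale a ` A)" using g value_set_rescale[OF A A' a] by simp
  \<comment> \<open>Rescaling \<open>?f\<close> turns its leading coefficient into
    \<open>a ^ \<gamma>\<close>; the scalar brings it back to 1. The same scalar cancels against the
    rescaled x^\<gamma>, so that no factor remains in front of \<open>u_poly\<close>.\<close>
  have "rescale a (smult (inverse a ^ \<gamma>) ?f) \<in> rescale a ` A"
    using canonical_basis_iff[OF A g] algebras_closed(5)[OF A] by blast
  then have "smult (inverse a ^ \<gamma>) (rescale a ?f) = canonical_basis m (rescale a ` A) \<gamma>"
    unfolding canonical_basis_iff[OF A' g'] unfolding value_set_rescale[OF A A' a]
    using canonical_basis_iff[OF A g, of ?f] a
    by (auto simp: pcompose_smult coeff_rescale power_inverse)
  also have "smult (inverse a ^ \<gamma>) (rescale a ?f) = monom 1 \<gamma> * rescale a (u_poly m A \<gamma>)"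
    unfolding u_poly_canonical_basis[OF A g]
    by (rule poly_eqI) (use a in \<open>simp add: coeff_rescale coeff_monom_mult power_inverse field_simps flip: power_add\<close>)
  finally show ?thesis unfolding u_poly_canonical_basis[OF A' g'] by simp
qed

lemma weight_vec_rescale: "a \<noteq> 0 \<Longrightarrow> weight_vec (rescale a u) = weight_vec u"
  by (simp add: weight_vec_def coeff_rescale)

text \<open>Reduces membership in \<open>B\<close> to the indecomposable exponents: products of
  their canonical elements realise every exponent of the value set, and subtracting multiples of
  such products raises the order of \<open>p\<close> up to \<open>m\<close>.\<close>

lemma rescale_mem:
  fixes A B :: "'a::field poly set"
  assumes A: "A \<in> \<A> m" and B: "B \<in> \<A> m"
    and ind: "\<And>\<nu>. \<nu> \<in> ind (value_set m A) \<Longrightarrow> rescale a (canonical_basis m A \<nu>) \<in> B"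
    and p: "p \<in> A"
  shows "rescale a p \<in> B"
proof -
  have gen: "\<exists>g\<in>A. rescale a g \<in> B \<and> coeff g \<gamma> = 1 \<and> (\<forall>j<\<gamma>. coeff g j = 0)" if "\<gamma> \<in> value_set m A" for \<gamma>
    using that
  proof (induction \<gamma> rule: less_induct)
    case (less \<gamma>)
    show ?case
    proof (cases "\<gamma> \<in> ind (value_set m A)")
      case True
      then show ?thesis using ind canonical_basis_iff[OF A less.prems] by blast
    next
      case False
      \<comment> \<open>The product of elements for the two summands serves \<open>\<gamma>\<close>;
        both summands are smaller because value sets contain only positive numbers.\<close>
      then obtain i j where ij: "i \<in> value_set m A" "j \<in> value_set m A" "\<gamma> = i + j"
        using less.prems unfolding ind_def decomposable_def by blast
      then have "i < \<gamma>" "j < \<gamma>" by (auto simp: value_set_def)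
      with less.IH ij obtain g h where g: "g \<in> A" "rescale a g \<in> B" "coeff g i = 1" "\<forall>k<i. coeff g k = 0"
        and h: "h \<in> A" "rescale a h \<in> B" "coeff h j = 1" "\<forall>k<j. coeff h k = 0" by metis
      obtain r s where r: "g = monom 1 i * r" and s: "h = monom 1 j * s"
        using g(4) h(4) monom_1_dvd_iff' by (metis dvdE)
      have gh: "g * h = monom 1 \<gamma> * (r * s)"
        unfolding r s ij(3) by (simp add: mult_monom ac_simps flip: mult.assoc)
      have "coeff r 0 = 1" "coeff s 0 = 1" using g(3) h(3) by (simp_all add: r s coeff_monom_mult)
      then have "coeff (r * s) 0 = 1" by (simp add: coeff_mult)
      then have "coeff (g * h) \<gamma> = 1 \<and> (\<forall>k<\<gamma>. coeff (g * h) k = 0)"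
        by (simp add: gh coeff_monom_mult)
      moreover have "g * h \<in> A" "rescale a (g * h) \<in> B"
        using g h algebras_closed(6)[OF A] algebras_closed(6)[OF B] by (simp_all add: pcompose_mult)
      ultimately show ?thesis by blast
    qed
  qed
  \<comment> \<open>Induction on the distance of the order bound \<open>k\<close> from
    \<open>m\<close>. By truncated subtraction, \<open>n = 0\<close> means k \<ge> m, and then x^m
    K[x] \<subseteq> B suffices.\<close>
  have "\<forall>p\<in>A. (\<forall>j<k. coeff p j = 0) \<longrightarrow> rescale a p \<in> B" if "m - k = n" for k n
    using that
  proof (induction n arbitrary: k)
    case 0
    show ?case
    proof (intro ballI impI)
      fix p assume "p \<in> A" "\<forall>j<k. coeff p j = 0"
      then show "rescale a p \<in> B" by (intro monom_mult_mem[OF B]) (use 0 in \<open>simp add: coeff_rescale\<close>)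
    qed
  next
    case (Suc n)
    show ?case
    proof (intro ballI impI)
      fix p assume p: "p \<in> A" "\<forall>j<k. coeff p j = 0"
      \<comment> \<open>Order 0 is outside the value set; there the constant 1 takes the place of an
        element from \<open>gen\<close>.\<close>
      have "\<exists>g\<in>A. rescale a g \<in> B \<and> coeff g k = 1 \<and> (\<forall>j<k. coeff g j = 0)" if nz: "coeff p k \<noteq> 0"
      proof (cases "k = 0")
        case True
        then show ?thesis using algebras_closed(2)[OF A] algebras_closed(2)[OF B]
          by (intro bexI[of _ 1]) (simp_all add: pcompose_1)
      next
        case False
        then have "k \<in> value_set m A" using value_set_mem[OF A p(1)] p(2) nz Suc.prems by simp
        then show ?thesis by (rule gen)
      qed
      \<comment> \<open>In this multiplied form the condition also admits g = 0, the choice when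
        \<open>coeff p k\<close> is already zero.\<close>
      then obtain g where g: "g \<in> A" "rescale a g \<in> B" "coeff p k = coeff p k * coeff g k" "\<forall>j<k. coeff g j = 0"
      proof (cases "coeff p k = 0")
        case True
        then show ?thesis using that[of 0] algebras_closed(1)[OF A] algebras_closed(1)[OF B] by simp
      qed auto
      let ?q = "p - smult (coeff p k) g"
      have "?q \<in> A" using p g algebras_closed(4,5)[OF A] by blast
      moreover have "\<forall>j<Suc k. coeff ?q j = 0" using p(2) g(3,4) by (auto simp: less_Suc_eq)
      moreover have "m - Suc k = n" using Suc.prems by simp
      ultimately have "rescale a ?q \<in> B" using Suc.IH by blast
      then have "rescale a ?q + smult (coeff p k) (rescale a g) \<in> B"
        using algebras_closed(3,5)[OF B] g(2) by blast
      then show "rescale a p \<in> B" by (simp add: pcompose_diff pcompose_smult)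
    qed
  qed
  from this[of 0] show ?thesis using p by simp
qed

section \<open>The torus action\<close>

text \<open>Each coefficient list is the image of its weight list, so pairing weights with
  coefficients respects the blocks.\<close>

lemma torus_act_concat:
  "torus_act (concat (map W xs)) t (concat (map (\<lambda>x. map (C x) (W x)) xs)) =
    concat (map (\<lambda>x. map (\<lambda>n. t ^ n * C x n) (W x)) xs)"
proof (induction xs)
  case (Cons x xs)
  have "map2 (\<lambda>n c. t ^ n * c) ns (map h ns) = map (\<lambda>n. t ^ n * h n) ns" for ns and h :: "nat \<Rightarrow> 'a"
    by (induction ns) auto
  then show ?case using Cons by (simp add: torus_act_def)
qed (simp add: torus_act_def)

lemma torus_act_torus_act:
  "torus_act ns s (torus_act ns t cs) = torus_act ns (s * t) cs"
  unfolding torus_act_def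
  by (induction ns cs rule: list_induct2') (auto simp: power_mult_distrib mult.assoc)

lemma torus_act_1: "length ns = length cs \<Longrightarrow> torus_act ns 1 cs = cs"
  unfolding torus_act_def by (induction ns cs rule: list_induct2) auto

text \<open>Orbits of a group action coincide once they meet. The length hypotheses keep
  \<open>map2\<close> from truncating, so that 1 acts as the identity.\<close>

lemma torus_orbit_eq_iff:
  assumes "length ns = length cs" "length ns = length ds"
  shows "torus_orbit ns cs = torus_orbit ns ds \<longleftrightarrow> (\<exists>t. t \<noteq> 0 \<and> ds = torus_act ns t cs)"
proof
  assume "torus_orbit ns cs = torus_orbit ns ds"
  moreover have "ds \<in> torus_orbit ns ds"
    unfolding torus_orbit_def using torus_act_1[OF assms(2)] by (auto intro: exI[of _ 1])
  ultimately show "\<exists>t. t \<noteq> 0 \<and> ds = torus_act ns t cs" unfolding torus_orbit_def by blast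
next
  assume "\<exists>t. t \<noteq> 0 \<and> ds = torus_act ns t cs"
  then obtain t where t: "t \<noteq> 0" "ds = torus_act ns t cs" by blast
  have "torus_act ns s cs = torus_act ns (s / t) ds" for s using t by (simp add: torus_act_torus_act)
  moreover have "torus_act ns s ds = torus_act ns (s * t) cs" for s using t by (simp add: torus_act_torus_act)
  ultimately show "torus_orbit ns cs = torus_orbit ns ds"
    unfolding torus_orbit_def using t(1) by (metis (no_types, opaque_lifting) divide_eq_0_iff mult_eq_0_iff)
qed

section \<open>Comparing coefficient vectors\<close>

lemma concat_map_eq_iff:
  "concat (map (\<lambda>x. map (C x) (W x)) xs) = concat (map (\<lambda>x. map (D x) (W x)) xs) \<longleftrightarrow>
    (\<forall>x\<in>set xs. \<forall>n\<in>set (W x). C x n = D x n)"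
  by (induction xs) auto

lemma length_coeffs_of: "length (weights m A) = length (coeffs_of m A)"
  unfolding weights_def coeffs_of_def coeff_vec_def by (simp add: length_concat comp_def)

text \<open>The vectors record only nonzero coefficients of positive degree; equal weights supply
  the rest, namely that the supports agree.\<close>

lemma coeffs_of_eq_torus_act_iff:
  fixes A B :: "'a::field poly set"
  assumes A: "A \<in> \<A> m" and B: "B \<in> \<A> m" and V: "value_set m A = value_set m B" and t: "t \<noteq> 0"
    and W: "\<And>\<nu>. \<nu> \<in> ind (value_set m A) \<Longrightarrow> weight_vec (u_poly m A \<nu>) = weight_vec (u_poly m B \<nu>)"
  shows "coeffs_of m B = torus_act (weights m A) t (coeffs_of m A) \<longleftrightarrow>
    (\<forall>\<nu>\<in>ind (value_set m A). u_poly m B \<nu> = rescale t (u_poly m A \<nu>))"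
proof -
  have "finite (value_set m A)" by (rule finite_subset[of _ "{..m}"]) (auto simp: value_set_def)
  then have fin: "finite (ind (value_set m A))" unfolding ind_def by simp
  have wv: "set (weight_vec u) = {k. 0 < k \<and> coeff u k \<noteq> 0}" for u :: "'a poly"
  proof -
    have "finite {k. 0 < k \<and> coeff u k \<noteq> 0}"
      by (rule finite_subset[of _ "{..degree u}"]) (auto simp: le_degree)
    then show ?thesis unfolding weight_vec_def by simp
  qed
  let ?L = "sorted_list_of_set (ind (value_set m A))"
  have "coeffs_of m B = concat (map (\<lambda>\<nu>. map (coeff (u_poly m B \<nu>)) (weight_vec (u_poly m A \<nu>))) ?L)"
    unfolding coeffs_of_def coeff_vec_def V[symmetric]
    by (intro arg_cong[of _ _ concat] map_cong) (use W fin in auto)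
  then have "coeffs_of m B = torus_act (weights m A) t (coeffs_of m A) \<longleftrightarrow>
    (\<forall>\<nu>\<in>ind (value_set m A). \<forall>n\<in>set (weight_vec (u_poly m A \<nu>)).
      coeff (u_poly m B \<nu>) n = t ^ n * coeff (u_poly m A \<nu>) n)"
    unfolding weights_def coeffs_of_def[of m A] coeff_vec_def torus_act_concat
    using fin by (simp add: concat_map_eq_iff)
  also have "\<dots> \<longleftrightarrow> (\<forall>\<nu>\<in>ind (value_set m A). u_poly m B \<nu> = rescale t (u_poly m A \<nu>))"
  proof (rule ball_cong[OF refl])
    fix \<nu> assume \<nu>: "\<nu> \<in> ind (value_set m A)"
    then have v: "\<nu> \<in> value_set m A" "\<nu> \<in> value_set m B" using V by (auto simp: ind_def)
    have same: "n \<in> set (weight_vec (u_poly m A \<nu>)) \<longleftrightarrow> 0 < n \<and> coeff (u_poly m B \<nu>) n \<noteq> 0" for n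
      unfolding W[OF \<nu>] wv by simp
    \<comment> \<open>At an unlisted index either both coefficients vanish, or n = 0 and both are
      1.\<close>
    have "coeff (u_poly m B \<nu>) n = t ^ n * coeff (u_poly m A \<nu>) n"
      if "n \<notin> set (weight_vec (u_poly m A \<nu>))" for n
      using that same[of n] coeff_u_poly_0[OF A v(1)] coeff_u_poly_0[OF B v(2)]
      by (cases "n = 0") (simp_all add: wv)
    then show "(\<forall>n\<in>set (weight_vec (u_poly m A \<nu>)). coeff (u_poly m B \<nu>) n = t ^ n * coeff (u_poly m A \<nu>) n)
        \<longleftrightarrow> u_poly m B \<nu> = rescale t (u_poly m A \<nu>)"
      unfolding poly_eq_iff coeff_rescale by blast
  qed
  finally show ?thesis .
qed

text \<open>Rescaling sends the canonical element of \<open>A\<close> at \<open>\<nu>\<close> to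
  \<open>t ^ \<nu>\<close> times that of \<open>B\<close>, so \<open>rescale_mem\<close>
  applies.\<close>

lemma rescale_image_subset:
  fixes A B :: "'a::field poly set"
  assumes A: "A \<in> \<A> m" and B: "B \<in> \<A> m" and V: "value_set m A = value_set m B"
    and u: "\<And>\<nu>. \<nu> \<in> ind (value_set m A) \<Longrightarrow> u_poly m B \<nu> = rescale t (u_poly m A \<nu>)"
  shows "rescale t ` A \<subseteq> B"
proof
  fix q assume "q \<in> rescale t ` A"
  then obtain p where p: "p \<in> A" "q = rescale t p" by blast
  have "rescale t (canonical_basis m A \<nu>) \<in> B" if \<nu>: "\<nu> \<in> ind (value_set m A)" for \<nu>
  proof -
    have v: "\<nu> \<in> value_set m A" "\<nu> \<in> value_set m B" using V \<nu> by (auto simp: ind_def)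
    have "rescale t (canonical_basis m A \<nu>) = smult (t ^ \<nu>) (canonical_basis m B \<nu>)"
      unfolding u_poly_canonical_basis[OF A v(1)] u_poly_canonical_basis[OF B v(2)] u[OF \<nu>]
      by (rule poly_eqI) (simp add: coeff_rescale coeff_monom_mult flip: power_add)
    moreover have "canonical_basis m B \<nu> \<in> B" using canonical_basis_iff[OF B v(2)] by blast
    ultimately show ?thesis using algebras_closed(5)[OF B] by simp
  qed
  then show "q \<in> B" unfolding p(2) using rescale_mem[OF A B _ p(1)] by blast
qed

theorem proposition3p3:
  fixes A A' :: "'a::field poly set"
  assumes "A \<in> \<A>\<^sub>\<Gamma> m \<Gamma>" and "A' \<in> \<A>\<^sub>\<Gamma> m' \<Gamma>'"
  shows "A \<simeq>\<^sub>K A' \<longleftrightarrow>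
           \<Gamma> = \<Gamma>' \<and> m = m' \<and>
           (\<forall>\<nu>\<in>ind \<Gamma>. weight_vec (u_poly m A \<nu>) = weight_vec (u_poly m' A' \<nu>)) \<and>
           torus_orbit (weights m A) (coeffs_of m A) = torus_orbit (weights m' A') (coeffs_of m' A')"
    (is "_ \<longleftrightarrow> ?R")
proof -
  have A: "A \<in> \<A> m" "value_set m A = \<Gamma>" and A': "A' \<in> \<A> m'" "value_set m' A' = \<Gamma>'"
    using assms by (auto simp: algebras_with_def)
  \<comment> \<open>Each orbit is formed with the weights of its own algebra; this identification
    makes them orbits of one action.\<close>
  have weights: "weights m A' = weights m A"
    if "\<Gamma> = \<Gamma>'" "m = m'" "\<forall>\<nu>\<in>ind \<Gamma>. weight_vec (u_poly m A \<nu>) = weight_vec (u_poly m' A' \<nu>)"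
  proof -
    have "finite (value_set m A)" by (rule finite_subset[of _ "{..m}"]) (auto simp: value_set_def)
    then have "finite (ind \<Gamma>)" unfolding ind_def A(2) by simp
    then show ?thesis using that A(2) A'(2) unfolding weights_def
      by (intro arg_cong[of _ _ concat] map_cong) auto
  qed
  show ?thesis
  proof
    assume "A \<simeq>\<^sub>K A'"
    then obtain a where a: "a \<noteq> 0" "m = m'" "A' = rescale a ` A"
      using iso_imp_rescale[OF A(1) A'(1)] by blast
    have B: "rescale a ` A \<in> \<A> m" using A'(1) a by simp
    have \<Gamma>: "\<Gamma> = \<Gamma>'" using value_set_rescale[OF A(1) B a(1)] A A' a by simp
    have u: "u_poly m A' \<nu> = rescale a (u_poly m A \<nu>)" if "\<nu> \<in> ind \<Gamma>" for \<nu>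
      using u_poly_rescale[OF A(1) B a(1)] that a A by (auto simp: ind_def)
    have W: "\<forall>\<nu>\<in>ind \<Gamma>. weight_vec (u_poly m A \<nu>) = weight_vec (u_poly m' A' \<nu>)"
      using u a by (simp add: weight_vec_rescale)
    have "coeffs_of m A' = torus_act (weights m A) a (coeffs_of m A)"
      using coeffs_of_eq_torus_act_iff[of A m A' a] A A' a(1,2) \<Gamma> W u by simp
    then show ?R using \<Gamma> W a(1,2) weights[OF \<Gamma> a(2) W] length_coeffs_of[of m A] length_coeffs_of[of m A']
      torus_orbit_eq_iff[of "weights m A" "coeffs_of m A" "coeffs_of m A'"] by auto
  next
    assume R: ?R
    then have W: "\<forall>\<nu>\<in>ind \<Gamma>. weight_vec (u_poly m A \<nu>) = weight_vec (u_poly m A' \<nu>)"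
      and m: "m = m'" and V: "value_set m A = value_set m A'" using A A' by auto
    have w: "weights m A' = weights m A" using R weights by blast
    then obtain t where t: "t \<noteq> 0" "coeffs_of m A' = torus_act (weights m A) t (coeffs_of m A)"
      using R length_coeffs_of[of m A] length_coeffs_of[of m A']
        torus_orbit_eq_iff[of "weights m A" "coeffs_of m A" "coeffs_of m A'"] by auto
    have B: "A' \<in> \<A> m" using A' m by simp
    have u: "u_poly m A' \<nu> = rescale t (u_poly m A \<nu>)" if "\<nu> \<in> ind (value_set m A)" for \<nu>
      using coeffs_of_eq_torus_act_iff[OF A(1) B V t(1)] t(2) W A(2) that by blast
    have inv: "inverse t * t = 1" "t * inverse t = 1" using t(1) by simp_all
    have "rescale t ` A \<subseteq> A'" by (rule rescale_image_subset[OF A(1) B V u])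
    \<comment> \<open>The reverse inclusion is the same lemma for the inverse scalar, with the two
      algebras exchanged.\<close>
    moreover have "rescale (inverse t) ` A' \<subseteq> A"
      by (rule rescale_image_subset[OF B A(1) V[symmetric]])
        (simp add: u rescale_rescale[OF inv(1)] flip: V)
    then have "q = rescale t (rescale (inverse t) q)" "rescale (inverse t) q \<in> A" if "q \<in> A'" for q
      using that by (auto simp: rescale_rescale[OF inv(2)])
    then have "A' \<subseteq> rescale t ` A" by blast
    ultimately have "A' = rescale t ` A" by blast
    then show "A \<simeq>\<^sub>K A'" using rescale_imp_iso[OF t(1)] by simp
  qed
qed

end
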